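(* Let $D$ be an $n\times n$ unit spherical EDM of embedding dimension $r$, let $B=-JDJ/2$, let $Z$ be a Gale matrix of $D$ (when $r\le n-2$), let $w=D^\dagger e$, and let $1\le k<l\le n$. Assume that $w_k=c\,w_l\neq 0$ (for a scalar $c$) and that either $r=n-1$ or $z^k=z^l=0$. Then $$T^{=}_{kl}=\begin{cases}\{0\} & \text{if } \|s^k\|^2=c^2\|s^l\|^2,\\ \{0,\theta_c\} & \text{otherwise,}\end{cases}\qquad\text{where }\theta_c=\frac{-4c}{\|s^k-c\,s^l\|^2}.$$
   Context: An $n\times n$ real matrix $D=(d_{ij})$ is a Euclidean distance matrix (EDM) if there are points $p^1,\dots,p^n$ (generating points) in some Euclidean space with $d_{ij}=\|p^i-p^j\|^2$ for all $i,j$; the dimension of their affine span is the embedding dimension $r$ of $D$. $D$ is spherical of radius $\rho$ if its generating points, taken in $\mathbb{R}^r$, lie on a sphere of radius $\rho$ in $\mathbb{R}^r$ (equivalently, there is a scalar $\beta$ with $\beta ee^T-D\succeq 0$, and the smallest such $\beta$ is $2\rho^2$; $D=0$ counts as spherical of radius $0$). A unit spherical EDM is a spherical EDM of radius $1$. $e$ is the all-ones vector in $\mathbb{R}^n$, $M^\dagger$ is the Moore-Penrose inverse, and $w=D^\dagger e$ satisfies $Dw=e$. If $r\le n-2$, a Gale matrix $Z$ of $D$ is an $n\times(n-r-1)$ matrix whose columns form a basis of $\{x\in\mathbb{R}^n: P^Tx=0,\ e^Tx=0\}$, where $P$ is the $n\times r$ matrix whose rows are generating points of $D$ in $\mathbb{R}^r$;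 $(z^i)^T$ denotes the $i$th row of $Z$. Let $J=I-ee^T/n$ and $B=-\tfrac12 JDJ=PP^T$ with $P$ of size $n\times r$ and full column rank. Put $S=P(P^TP)^{-1}$ and let $(s^i)^T$ be the $i$th row of $S$ (so $SS^T=B^\dagger$ and $(s^i)^Ts^j=B^\dagger_{ij}$). $E^{kl}$ is the $n\times n$ symmetric matrix with $1$'s in positions $kl$ and $lk$ and zeros elsewhere. $T^{=}_{kl}$ is the set of real $t$ such that $D+tE^{kl}$ is a unit spherical EDM. *)

theory Defs
  imports "HOL-Analysis.Analysis"
begin

definition Moore_Penrose :: "real^'n^'m \<Rightarrow> real^'m^'n \<Rightarrow> bool" where
  "Moore_Penrose A X \<longleftrightarrow>
     A ** X ** A = A \<and> X ** A ** X = X \<and>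
     transpose (A ** X) = A ** X \<and> transpose (X ** A) = X ** A"

definition pinv :: "real^'n^'m \<Rightarrow> real^'m^'n" where
  "pinv A = (THE X. Moore_Penrose A X)"

definition centering :: "real^'n^'n" where
  "centering = mat 1 - (1 / real CARD('n)) *\<^sub>R (\<chi> i j. 1)"

definition generating_points :: "('n \<Rightarrow> 'a::euclidean_space) \<Rightarrow> real^'n^'n \<Rightarrow> bool" where
  "generating_points p D \<longleftrightarrow> (\<forall>i j. D $ i $ j = (norm (p i - p j))\<^sup>2)"

text \<open>
  The index type of the matrix also serves as the dimension of the ambient space of the
  generating points in the next two definitions. This is no restriction: \<open>n\<close> points
  always fit isometrically into \<open>n\<close>-space; see \<open>embedding_dim_eq\<close> and
  \<open>spherical_edmI\<close> below, which allow points in an arbitrary Euclidean space.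
\<close>

definition embedding_dim :: "real^'n^'n \<Rightarrow> nat" where
  "embedding_dim D =
     (THE r. \<exists>p :: 'n \<Rightarrow> real^'n. generating_points p D \<and> aff_dim (range p) = int r)"

text \<open>
  Placing the centre in the affine hull of the points expresses that the sphere is taken in
  the space of dimension \<open>embedding_dim D\<close> spanned by them; otherwise the radius would not be
  unique.
\<close>

definition spherical_edm :: "real^'n^'n \<Rightarrow> real \<Rightarrow> bool" where
  "spherical_edm D \<rho> \<longleftrightarrow>
     (\<exists>p :: 'n \<Rightarrow> real^'n. generating_points p D \<and>
        (\<exists>a \<in> affine hull (range p). \<forall>i. norm (p i - a) = \<rho>))"

definition unit_spherical_edm :: "real^'n^'n \<Rightarrow> bool" where
  "unit_spherical_edm D \<longleftrightarrow> spherical_edm D 1"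

text \<open>
  \<open>Z\<close> is a Gale matrix of \<open>D\<close>, formed from the \<open>n \<times> r\<close> matrix \<open>P\<close> of generating points in
  \<open>r\<close>-space, with \<open>r\<close> the embedding dimension. Since index types are nonempty, \<open>r \<le> n - 2\<close>
  is implied.
\<close>

definition gale_matrix :: "real^'n^'n \<Rightarrow> real^'r^'n \<Rightarrow> real^'m^'n \<Rightarrow> bool" where
  "gale_matrix D P Z \<longleftrightarrow>
     embedding_dim D = CARD('r) \<and> generating_points (\<lambda>i. row i P) D \<and>
     CARD('m) + CARD('r) + 1 = CARD('n) \<and>
     inj (\<lambda>j. column j Z) \<and> independent (columns Z) \<and>
     span (columns Z) = {x. transpose P *v x = 0 \<and> (\<Sum>i\<in>UNIV. x $ i) = 0}"

definition sym_unit :: "'n \<Rightarrow> 'n \<Rightarrow> real^'n^'n" where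
  "sym_unit k l = (\<chi> i j. if i = k \<and> j = l \<or> i = l \<and> j = k then 1 else 0)"

definition unit_spherical_set :: "real^'n^'n \<Rightarrow> 'n \<Rightarrow> 'n \<Rightarrow> real set" where
  "unit_spherical_set D k l = {t. unit_spherical_edm (D + t *\<^sub>R sym_unit k l)}"


text \<open>Independence of the choice of generating points\<close>

lemma generating_points_transfer:
  fixes p :: "'n::finite \<Rightarrow> 'a::euclidean_space"
  assumes p: "generating_points p D"
  obtains q :: "'n \<Rightarrow> real^'n" where "generating_points q D"
    "aff_dim (range q) = aff_dim (range p)"
    "\<And>a \<rho>. a \<in> affine hull (range p) \<Longrightarrow> \<forall>i. norm (p i - a) = \<rho> \<Longrightarrow>
        \<exists>b \<in> affine hull (range q). \<forall>i. norm (q i - b) = \<rho>"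
proof -
  obtain i0 :: 'n where True by simp
  define u where "u i = p i - p i0" for i
  define S where "S = span (range u)"
  have S: "subspace S" by (simp add: S_def)
  have uS: "u i \<in> S" for i by (simp add: S_def span_base)
  have "dim S \<le> card (range u)" by (simp add: S_def dim_le_card')
  also have "\<dots> \<le> CARD('n)" by (simp add: card_image_le)
  finally have "dim S \<le> dim (UNIV :: (real^'n) set)" by simp
  then obtain T :: "(real^'n) set" where T: "subspace T" "dim T = dim S"
    using choose_subspace_of_subspace[of "dim S" "UNIV :: (real^'n) set"] by auto
  obtain f where f: "linear f" "f ` S = T" "\<And>x. x \<in> S \<Longrightarrow> norm (f x) = norm x"
    using isometry_subspaces[OF S T(1)] T(2) by metis
  have inj: "inj_on f S"
    using linear_inj_on_iff_eq_0[OF f(1) S] f(3) by fastforce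
  define q where "q i = f (u i)" for i
  have uij: "u i - u j = p i - p j" for i j by (simp add: u_def)
  have "norm (q i - q j) = norm (p i - p j)" for i j
    using f(3)[OF subspace_diff[OF S uS uS], of i j]
    by (simp only: q_def linear_diff[OF f(1), symmetric]) (simp add: uij)
  with p have 1: "generating_points q D" by (simp add: generating_points_def)
  have ru: "range u = (\<lambda>x. x - p i0) ` range p" by (auto simp: u_def)
  have rq: "range q = f ` range u" by (auto simp: q_def)
  have u0: "0 \<in> range u" by (rule image_eqI[of _ _ i0]) (auto simp: u_def)
  have q0: "0 \<in> range q" using u0 rq linear_0[OF f(1)] by (metis imageI)
  have "aff_dim (range q) = int (dim (range q))"
    using aff_dim_zero[of "range q"] q0 by (simp add: hull_inc)
  also have "dim (range q) = dim (range u)"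
    using dim_image_eq[OF f(1), of "range u"] inj by (simp add: rq S_def)
  also have "int (dim (range u)) = aff_dim (range u)"
    using aff_dim_zero[of "range u"] u0 by (simp add: hull_inc)
  also have "\<dots> = aff_dim (range p)"
    using ru aff_dim_translation_eq_subtract[of "p i0" "range p"] by simp
  finally have 2: "aff_dim (range q) = aff_dim (range p)" .
  have 3: "\<exists>b \<in> affine hull (range q). \<forall>i. norm (q i - b) = \<rho>"
    if a: "a \<in> affine hull (range p)" "\<forall>i. norm (p i - a) = \<rho>" for a \<rho>
  proof -
    have ahu: "affine hull (range u) = (\<lambda>x. x - p i0) ` (affine hull (range p))"
      using affine_hull_translation[of "- p i0" "range p"] ru by simp
    then have au: "a - p i0 \<in> affine hull (range u)" using a by blast
    then have aS: "a - p i0 \<in> S" using affine_hull_subset_span S_def by blast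
    have ahq: "affine hull (range q) = f ` (affine hull (range u))"
      using affine_hull_linear_image[of f "range u"] f(1) rq by (simp add: linear_conv_bounded_linear)
    have "norm (q i - f (a - p i0)) = \<rho>" for i
      using f(3)[OF subspace_diff[OF S uS aS], of i] a(2)
      by (simp add: q_def linear_diff[OF f(1)] u_def)
    then show ?thesis using au ahq by blast
  qed
  show ?thesis using that 1 2 3 by blast
qed

lemma generating_points_norm_sum:
  fixes p :: "'n::finite \<Rightarrow> 'a::euclidean_space"
  assumes "generating_points p D"
  shows "(norm (\<Sum>i\<in>UNIV. c i *\<^sub>R (p i - p i0)))\<^sup>2 =
    (\<Sum>i\<in>UNIV. \<Sum>j\<in>UNIV. c i * c j * ((D $ i $ i0 + D $ j $ i0 - D $ i $ j) / 2))"
proof -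
  have *: "(p i - p i0) \<bullet> (p j - p i0) = (D $ i $ i0 + D $ j $ i0 - D $ i $ j) / 2" for i j
  proof -
    have D: "D $ a $ b = p a \<bullet> p a - 2 * (p a \<bullet> p b) + p b \<bullet> p b" for a b
      using assms
      by (simp add: generating_points_def power2_norm_eq_inner algebra_simps inner_commute)
    show ?thesis by (simp add: D algebra_simps inner_commute)
  qed
  have "(norm (\<Sum>i\<in>UNIV. c i *\<^sub>R (p i - p i0)))\<^sup>2 =
      (\<Sum>j\<in>UNIV. \<Sum>i\<in>UNIV. c i * c j * ((p i - p i0) \<bullet> (p j - p i0)))"
    unfolding power2_norm_eq_inner inner_sum_left inner_sum_right
    by (simp add: mult_ac sum_distrib_left inner_commute)
  then show ?thesis unfolding * by (subst sum.swap)
qed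

lemma generating_points_dim_le:
  fixes p :: "'n::finite \<Rightarrow> 'a::euclidean_space" and q :: "'n \<Rightarrow> 'b::euclidean_space"
  assumes p: "generating_points p D" and q: "generating_points q D"
  shows "aff_dim (range p) \<le> aff_dim (range q)"
proof -
  obtain i0 :: 'n where True by simp
  define u where "u i = p i - p i0" for i
  define v where "v i = q i - q i0" for i
  have ru: "range u = (\<lambda>x. x - p i0) ` range p" by (auto simp: u_def)
  have rv: "range v = (\<lambda>x. x - q i0) ` range q" by (auto simp: v_def)
  have adu: "aff_dim (range p) = int (dim (range u))"
    using aff_dim_eq_dim_subtract[of "p i0" "range p"] by (simp add: ru hull_inc)
  have adv: "aff_dim (range q) = int (dim (range v))"
    using aff_dim_eq_dim_subtract[of "q i0" "range q"] by (simp add: rv hull_inc)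
  have key: "(\<Sum>i\<in>UNIV. c i *\<^sub>R v i) = 0 \<Longrightarrow> (\<Sum>i\<in>UNIV. c i *\<^sub>R u i) = 0" for c
    using generating_points_norm_sum[OF p, of c i0] generating_points_norm_sum[OF q, of c i0]
    by (simp add: u_def v_def)
  obtain B where B: "B \<subseteq> range u" "independent B" "card B = dim (range u)"
    using basis_exists by metis
  obtain I where I: "B = u ` I" "inj_on u I"
    using B(1) by (meson subset_image_inj)
  have *: "\<forall>i\<in>I. c i = 0" if "(\<Sum>i\<in>I. c i *\<^sub>R v i) = 0" for c
  proof -
    define d where "d i = (if i \<in> I then c i else 0)" for i
    have "(\<Sum>i\<in>UNIV. d i *\<^sub>R v i) = (\<Sum>i\<in>I. c i *\<^sub>R v i)"
      by (rule sum.mono_neutral_cong_right) (auto simp: d_def)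
    then have "(\<Sum>i\<in>UNIV. d i *\<^sub>R u i) = 0" using that key by metis
    moreover have "(\<Sum>i\<in>UNIV. d i *\<^sub>R u i) = (\<Sum>i\<in>I. c i *\<^sub>R u i)"
      by (rule sum.mono_neutral_cong_right) (auto simp: d_def)
    ultimately have "(\<Sum>i\<in>I. c i *\<^sub>R u i) = 0" by simp
    then have "(\<Sum>b\<in>B. c (the_inv_into I u b) *\<^sub>R b) = 0"
      using I by (simp add: sum.reindex the_inv_into_f_f cong: sum.cong)
    then have "\<forall>b\<in>B. c (the_inv_into I u b) = 0"
      using independentD[OF B(2), of B "\<lambda>b. c (the_inv_into I u b)"] I by auto
    then show ?thesis using I by (simp add: the_inv_into_f_f)
  qed
  have inj: "inj_on v I"
  proof (rule inj_onI, rule ccontr)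
    fix i j assume ij: "i \<in> I" "j \<in> I" "v i = v j" "i \<noteq> j"
    let ?c = "\<lambda>k. if k = i then 1 else if k = j then -1 else (0::real)"
    have "(\<Sum>k\<in>I. ?c k *\<^sub>R v k) = (\<Sum>k\<in>{i,j}. ?c k *\<^sub>R v k)"
      using ij by (intro sum.mono_neutral_right) auto
    also have "\<dots> = 0" using ij by simp
    finally have "?c i = 0" using *[of ?c] ij(1) by blast
    then show False by simp
  qed
  have "independent (v ` I)"
  proof (rule independent_if_scalars_zero)
    show "finite (v ` I)" by simp
    fix f x assume "(\<Sum>x\<in>v ` I. f x *\<^sub>R x) = 0" "x \<in> v ` I"
    then show "f x = 0" using *[of "\<lambda>i. f (v i)"] inj by (auto simp: sum.reindex)
  qed
  then have "card (v ` I) \<le> dim (range v)"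
    by (intro independent_card_le_dim) auto
  then show ?thesis using adu adv B(3) I inj by (simp add: card_image)
qed

lemma embedding_dim_eq:
  fixes p :: "'n::finite \<Rightarrow> 'a::euclidean_space"
  assumes p: "generating_points p D"
  shows "int (embedding_dim D) = aff_dim (range p)"
proof -
  obtain q :: "'n \<Rightarrow> real^'n" where q: "generating_points q D"
      "aff_dim (range q) = aff_dim (range p)"
    using generating_points_transfer[OF p] by metis
  have "aff_dim (range q) \<ge> 0"
    by (metis UNIV_not_empty aff_dim_empty aff_dim_geq aff_dim_negative_iff image_is_empty leI)
  then have "embedding_dim D = nat (aff_dim (range q))"
    unfolding embedding_dim_def
  proof (intro the_equality exI conjI)
    show "generating_points q D" by (fact q)
    show "aff_dim (range q) = int (nat (aff_dim (range q)))" if "aff_dim (range q) \<ge> 0"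
      using that by simp
  next
    fix r assume "\<exists>p :: 'n \<Rightarrow> real^'n. generating_points p D \<and> aff_dim (range p) = int r"
    then show "r = nat (aff_dim (range q))"
      using generating_points_dim_le q(1) by (metis nat_int order_antisym)
  qed
  then show ?thesis using q \<open>aff_dim (range q) \<ge> 0\<close> by simp
qed

lemma spherical_edmI:
  fixes p :: "'n::finite \<Rightarrow> 'a::euclidean_space"
  assumes "generating_points p D" "a \<in> affine hull (range p)" "\<And>i. norm (p i - a) = \<rho>"
  shows "spherical_edm D \<rho>"
proof -
  obtain q :: "'n \<Rightarrow> real^'n" where "generating_points q D"
      "\<exists>b \<in> affine hull (range q). \<forall>i. norm (q i - b) = \<rho>"
    using generating_points_transfer[OF assms(1)] assms(2,3) by metis
  then show ?thesis unfolding spherical_edm_def by blast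
qed


text \<open>Existence and uniqueness of the Moore-Penrose inverse\<close>

lemma Moore_Penrose_unique:
  assumes X: "Moore_Penrose A X" and Y: "Moore_Penrose A Y"
  shows "X = Y"
proof -
  have x: "A ** X ** A = A" "X ** A ** X = X" "transpose (A ** X) = A ** X"
      "transpose (X ** A) = X ** A" using X by (auto simp: Moore_Penrose_def)
  have y: "A ** Y ** A = A" "Y ** A ** Y = Y" "transpose (A ** Y) = A ** Y"
      "transpose (Y ** A) = Y ** A" using Y by (auto simp: Moore_Penrose_def)
  have "A ** X = (A ** Y) ** (A ** X)" by (simp add: y(1) matrix_mul_assoc)
  also have "\<dots> = transpose ((A ** X) ** (A ** Y))"
    by (simp add: matrix_transpose_mul[of "A ** X"] x(3) y(3))
  also have "\<dots> = A ** Y" by (simp add: x(1) y(3) matrix_mul_assoc)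
  finally have 1: "A ** X = A ** Y" .
  have "X ** A = (X ** A) ** (Y ** A)" by (metis y(1) matrix_mul_assoc)
  also have "\<dots> = transpose ((Y ** A) ** (X ** A))"
    by (simp add: matrix_transpose_mul[of "Y ** A"] x(4) y(4))
  also have "\<dots> = Y ** A" by (metis x(1) y(4) matrix_mul_assoc)
  finally have 2: "X ** A = Y ** A" .
  show ?thesis by (metis 1 2 x(2) y(2) matrix_mul_assoc)
qed

lemma Moore_Penrose_exists: "\<exists>X. Moore_Penrose (A :: real^'n^'m) X"
proof -
  define R where "R = range ((*v) (transpose A))"
  define M where "M = transpose A ** A"
  have R: "subspace R"
    unfolding R_def by (rule linear_subspace_image) (auto simp: matrix_vector_mul_linear)
  have RI: "transpose A *v y \<in> R" for y by (simp add: R_def)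
  have M: "M *v x = transpose A *v (A *v x)" for x
    by (simp add: M_def matrix_vector_mul_assoc)
  have linM: "linear ((*v) M)" by (rule matrix_vector_mul_linear)
  have inj: "inj_on ((*v) M) R"
  proof (subst linear_inj_on_iff_eq_0[OF linM R], safe)
    fix x assume "x \<in> R" and Mx: "M *v x = 0"
    then obtain y where y: "x = transpose A *v y" by (auto simp: R_def)
    have "(A *v x) \<bullet> (A *v x) = x \<bullet> (M *v x)"
      by (metis M dot_lmul_matrix inner_commute transpose_matrix_vector)
    with Mx have "A *v x = 0" by simp
    moreover have "x \<bullet> x = y \<bullet> (A *v x)"
      by (metis y dot_lmul_matrix transpose_matrix_vector)
    ultimately show "x = 0" by simp
  qed
  have "(*v) M ` R \<subseteq> R" using M RI by auto
  moreover have "dim ((*v) M ` R) = dim R"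
    using dim_image_eq[OF linM, of R] inj R by (simp add: span_eq_iff[THEN iffD2])
  ultimately have MR: "(*v) M ` R = R"
    using R linM by (intro subspace_dim_equal) (auto intro: linear_subspace_image)
  obtain h where h: "linear h" "\<And>x. x \<in> R \<Longrightarrow> h (M *v x) = x"
    using linear_exists_left_inverse_on[OF linM R inj] by metis
  define X where "X = matrix h ** transpose A"
  have X: "X *v y = h (transpose A *v y)" for y
    unfolding X_def matrix_vector_mul_assoc[symmetric]
    by (rule matrix_works) (use h(1) in \<open>simp add: linear_matrix_vector_mul_eq\<close>)
  have hR: "h z \<in> R \<and> M *v h z = z" if "z \<in> R" for z
  proof -
    from that MR obtain x where "x \<in> R" "z = M *v x" by blast
    then show ?thesis using h(2) by simp
  qed
  have 1: "transpose A ** (A ** X) = transpose A"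
    by (simp add: matrix_eq matrix_vector_mul_assoc[symmetric] X M[symmetric] hR RI
        del: transpose_matrix_vector)
  have 2: "X ** A ** transpose A = transpose A"
    by (simp add: matrix_eq matrix_vector_mul_assoc[symmetric] X M[symmetric] h(2) RI
        del: transpose_matrix_vector)
  have 3: "transpose (A ** X) ** A = A"
    using arg_cong[OF 1, of transpose] by (simp add: matrix_transpose_mul)
  have 4: "A ** transpose (X ** A) = A"
    using arg_cong[OF 2, of transpose] by (simp add: matrix_transpose_mul matrix_mul_assoc)
  have 5: "transpose (A ** X) ** (A ** X) = A ** X" using 3 by (metis matrix_mul_assoc)
  then have s1: "transpose (A ** X) = A ** X" by (metis matrix_transpose_mul transpose_transpose)
  have "(X ** A) ** transpose (X ** A) = X ** A" using 4 by (metis matrix_mul_assoc)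
  then have s2: "transpose (X ** A) = X ** A" by (metis matrix_transpose_mul transpose_transpose)
  have "X ** A ** X = X"
    by (simp add: matrix_eq matrix_vector_mul_assoc[symmetric] X M[symmetric] hR RI
        del: transpose_matrix_vector)
  then show ?thesis using s1 s2 3 unfolding Moore_Penrose_def by metis
qed

lemma Moore_Penrose_pinv: "Moore_Penrose A (pinv A)"
  unfolding pinv_def using Moore_Penrose_exists Moore_Penrose_unique by (metis theI')

end

(*
  With all generating points on the unit sphere about 0, G = ee^T - D/2 is their Gram matrix.
  So D is a unit spherical EDM iff its diagonal vanishes, G is positive semidefinite and some u
  with Gu = 0 has coordinate sum 1 (the centre lies in the affine hull); here u = 2w works.
  Passing from D to D + tE^{kl} subtracts (t/2) E^{kl} from G. The Gale condition says that
  v = e_k - c e_l is orthogonal to ker G, so Gh = v is solvable, with the explicit solution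
  h = S S^T v of coordinate sum 0. Whether the perturbed matrix is again a Gram matrix of the
  required kind then depends only on h_k and h_l, which are inner products of rows of S.
*)
theory Submission
  imports Defs
begin

section \<open>Positive semidefinite matrices and Gram factorisation\<close>

definition psd :: "real^'n^'n \<Rightarrow> bool" where
  "psd G \<longleftrightarrow> transpose G = G \<and> (\<forall>x. 0 \<le> x \<bullet> (G *v x))"

lemma psd_sym: "psd G \<Longrightarrow> x \<bullet> (G *v y) = y \<bullet> (G *v x)"
  by (metis dot_lmul_matrix inner_commute psd_def transpose_matrix_vector)

lemma psd_index_sym: "psd G \<Longrightarrow> G $ i $ j = G $ j $ i"
  unfolding psd_def transpose_def by (metis vec_lambda_beta)

text \<open>The form of \<open>G\<close> is nonnegative on all combinations of \<open>x\<close> and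
  \<open>y\<close>. It may degenerate there, so the discriminant argument splits on whether
  \<open>d\<close> vanishes.\<close>

lemma psd_Cauchy_Schwarz:
  assumes "psd G"
  shows "(x \<bullet> (G *v y))\<^sup>2 \<le> (x \<bullet> (G *v x)) * (y \<bullet> (G *v y))"
proof -
  define a b d where "a = x \<bullet> (G *v x)" and "b = x \<bullet> (G *v y)" and "d = y \<bullet> (G *v y)"
  have *: "0 \<le> s\<^sup>2 * a + 2 * s * r * b + r\<^sup>2 * d" for s r
  proof -
    have "0 \<le> (s *\<^sub>R x + r *\<^sub>R y) \<bullet> (G *v (s *\<^sub>R x + r *\<^sub>R y))"
      using assms psd_def by blast
    also have "\<dots> = s\<^sup>2 * a + 2 * s * r * b + r\<^sup>2 * d"
      using psd_sym[OF assms, of x y]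
      by (simp add: a_def b_def d_def matrix_vector_right_distrib matrix_vector_mult_scaleR
          inner_add_left inner_add_right power2_eq_square algebra_simps)
    finally show ?thesis .
  qed
  have ad: "0 \<le> a" "0 \<le> d" using assms by (simp_all add: psd_def a_def d_def)
  have "b\<^sup>2 \<le> a * d"
  proof (cases "d = 0")
    case True
    have "b = 0"
    proof (rule ccontr)
      assume b: "b \<noteq> 0"
      \<comment> \<open>With \<open>d = 0\<close> and \<open>s = 1\<close> the expression is affine
        in \<open>r\<close>; this choice of \<open>r\<close> gives it the value -1.\<close>
      show False
        using *[of 1 "- (a + 1) / (2 * b)"] b ad True by (simp add: field_simps)
    qed
    then show ?thesis using ad by simp
  next
    case False
    \<comment> \<open>Up to scaling, \<open>d\<close> and \<open>- b\<close> are the coefficients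
      that minimise the form along the line \<open>x + r y\<close>.\<close>
    have "0 \<le> d * (a * d - b\<^sup>2)"
      using *[of d "- b"] by (simp add: power2_eq_square algebra_simps)
    then show ?thesis using False ad by (simp add: zero_le_mult_iff)
  qed
  then show ?thesis by (simp add: a_def b_def d_def)
qed

text \<open>Cauchy-Schwarz against the vector \<open>G *v x\<close> itself forces its norm to
  vanish.\<close>

lemma psd_null:
  assumes "psd G" "x \<bullet> (G *v x) = 0"
  shows "G *v x = 0"
proof -
  have "((G *v x) \<bullet> (G *v x))\<^sup>2 \<le> 0"
    using psd_Cauchy_Schwarz[OF assms(1), of "G *v x" x] assms(2) by simp
  then show ?thesis by simp
qed

text \<open>Cholesky factorisation: each step clears one row by subtracting a rank-one matrix.\<close>

lemma psd_gram_on: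
  fixes G :: "real^'n^'n"
  assumes "finite A" "psd G" "\<And>i j. i \<notin> A \<Longrightarrow> G $ i $ j = 0"
  shows "\<exists>p :: 'n \<Rightarrow> real^'n. (\<forall>i j. G $ i $ j = p i \<bullet> p j) \<and> (\<forall>i. \<forall>j. j \<notin> A \<longrightarrow> p i $ j = 0)"
  using assms
proof (induction A arbitrary: G rule: finite_induct)
  case empty
  then show ?case by (intro exI[of _ "\<lambda>i. 0"]) simp
next
  case (insert a A)
  have Ga: "(G *v x) $ a = x \<bullet> (G *v axis a 1)" for x
    by (metis cart_eq_inner_axis inner_commute psd_sym[OF insert.prems(1)])
  have Gia: "(G *v axis a 1) $ i = G $ i $ a" for i
    by (simp add: matrix_vector_mult_basis column_def)
  have aGa: "axis a 1 \<bullet> (G *v axis a 1) = G $ a $ a"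
    by (metis Gia cart_eq_inner_axis inner_commute)
  show ?case
  proof (cases "G $ a $ a = 0")
    case True
    then have "G *v axis a 1 = 0"
      using psd_null[OF insert.prems(1)] aGa by simp
    then have "G $ a $ j = 0" for j
      by (metis Gia psd_index_sym[OF insert.prems(1)] zero_index)
    then have "i \<notin> A \<Longrightarrow> G $ i $ j = 0" for i j
      using insert.prems(2) by (cases "i = a") auto
    then show ?thesis using insert.IH[OF insert.prems(1)] by (metis insertCI)
  next
    case False
    then have pos: "G $ a $ a > 0"
      using aGa insert.prems(1) unfolding psd_def by (metis less_eq_real_def)
    \<comment> \<open>The Schur complement of the entry at \<open>a\<close>: its row at
      \<open>a\<close> vanishes, so the induction hypothesis applies.\<close>
    define H where "H = (\<chi> i j. G $ i $ j - G $ i $ a * G $ j $ a / G $ a $ a)"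
    have Hx: "H *v x = G *v x - ((G *v x) $ a / G $ a $ a) *\<^sub>R (G *v axis a 1)" for x
    proof -
      have "(G *v x) $ a = (\<Sum>j\<in>UNIV. G $ j $ a * x $ j)"
        by (simp add: matrix_vector_mult_def psd_index_sym[OF insert.prems(1), of a])
      then show ?thesis
        by (simp add: vec_eq_iff Gia)
          (simp add: H_def matrix_vector_mult_def algebra_simps sum_subtractf sum_distrib_left
            sum_divide_distrib)
    qed
    have "psd H" unfolding psd_def
    proof (intro conjI allI)
      show "transpose H = H"
        using psd_index_sym[OF insert.prems(1)] by (simp add: H_def transpose_def vec_eq_iff)
      fix x
      \<comment> \<open>Cauchy-Schwarz with the basis vector at \<open>a\<close> is exactly the
        definiteness of the Schur complement.\<close>
      have "(x \<bullet> (G *v axis a 1))\<^sup>2 \<le> (x \<bullet> (G *v x)) * G $ a $ a"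
        using psd_Cauchy_Schwarz[OF insert.prems(1), of x "axis a 1"] aGa by simp
      then show "0 \<le> x \<bullet> (H *v x)"
        using pos by (simp add: Hx Ga inner_diff_right field_simps power2_eq_square)
    qed
    moreover have "H $ i $ j = 0" if "i \<notin> A" for i j
    proof (cases "i = a")
      case True
      then show ?thesis
        using pos psd_index_sym[OF insert.prems(1), of a j] by (simp add: H_def)
    next
      case False
      then show ?thesis using that insert.prems(2) by (simp add: H_def)
    qed
    ultimately obtain p :: "'n \<Rightarrow> real^'n" where p: "\<And>i j. H $ i $ j = p i \<bullet> p j"
      "\<And>i j. j \<notin> A \<Longrightarrow> p i $ j = 0" using insert.IH by metis
    \<comment> \<open>Coordinate \<open>a\<close> is still free because every \<open>p i\<close>
      vanishes off \<open>A\<close>; it carries the rank-one term subtracted in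
      \<open>H\<close>.\<close>
    define q where "q i = p i + (G $ i $ a / sqrt (G $ a $ a)) *\<^sub>R axis a 1" for i
    have "p i \<bullet> axis a 1 = 0" "axis a 1 \<bullet> p i = 0" for i
      using p(2)[of a i] insert.hyps(2) by (simp_all add: inner_axis inner_axis')
    then have "q i \<bullet> q j = H $ i $ j + G $ i $ a * G $ j $ a / G $ a $ a" for i j
      using pos by (simp add: q_def p(1) inner_add_left inner_add_right inner_axis_axis)
    then have "G $ i $ j = q i \<bullet> q j" for i j by (simp add: H_def)
    moreover have "q i $ j = 0" if "j \<notin> insert a A" for i j
      using that p(2) by (simp add: q_def axis_def)
    ultimately show ?thesis by blast
  qed
qed

lemma psd_gram:
  fixes G :: "real^'n^'n"
  assumes "psd G"
  obtains p :: "'n \<Rightarrow> real^'n" where "\<And>i j. G $ i $ j = p i \<bullet> p j"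
proof -
  have "\<exists>p :: 'n \<Rightarrow> real^'n. (\<forall>i j. G $ i $ j = p i \<bullet> p j) \<and> (\<forall>i. \<forall>j. j \<notin> UNIV \<longrightarrow> p i $ j = 0)"
    by (rule psd_gram_on[OF finite_class.finite_UNIV assms]) simp
  then show thesis using that by blast
qed

section \<open>Gram matrices, affine hulls and the unit sphere\<close>

lemma gram_quadratic_form:
  fixes p :: "'n::finite \<Rightarrow> 'a::real_inner"
  assumes "\<And>i j. G $ i $ j = p i \<bullet> p j"
  shows "x \<bullet> (G *v x) = (norm (\<Sum>i\<in>UNIV. x $ i *\<^sub>R p i))\<^sup>2"
proof -
  have "x \<bullet> (G *v x) = (\<Sum>i\<in>UNIV. \<Sum>j\<in>UNIV. x $ i * (x $ j * (p i \<bullet> p j)))"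
    unfolding inner_vec_def matrix_vector_mult_def assms by (simp add: sum_distrib_left mult_ac)
  also have "\<dots> = (norm (\<Sum>i\<in>UNIV. x $ i *\<^sub>R p i))\<^sup>2"
    unfolding power2_norm_eq_inner inner_sum_left
    unfolding inner_sum_right by (subst sum.swap) (simp add: mult.left_commute inner_commute)
  finally show ?thesis .
qed

text \<open>Points with different labels may coincide, so the weights are indexed by labels.
  Conversion to weights on the set \<open>range p\<close> adds them up over the fibres of
  \<open>p\<close>.\<close>

lemma affine_hull_range:
  fixes p :: "'n::finite \<Rightarrow> 'a::real_vector"
  shows "affine hull (range p) = {\<Sum>i\<in>UNIV. u $ i *\<^sub>R p i |u :: real^'n. (\<Sum>i\<in>UNIV. u $ i) = 1}"
    (is "_ = ?R")
proof
  show "affine hull (range p) \<subseteq> ?R"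
  proof (rule hull_minimal)
    show "range p \<subseteq> ?R"
    proof clarify
      fix i
      have "p i = (\<Sum>j\<in>UNIV. (axis i 1 :: real^'n) $ j *\<^sub>R p j)"
        by (simp add: axis_def if_distrib[of "\<lambda>x. x *\<^sub>R _"] cong: if_cong)
      moreover have "(\<Sum>j\<in>UNIV. (axis i 1 :: real^'n) $ j) = 1" by (simp add: axis_def)
      ultimately show "\<exists>u :: real^'n. p i = (\<Sum>j\<in>UNIV. u $ j *\<^sub>R p j) \<and> (\<Sum>j\<in>UNIV. u $ j) = 1"
        by blast
    qed
    show "affine ?R" unfolding affine_def
    proof clarify
      fix s t :: real and u v :: "real^'n"
      assume "s + t = 1" "(\<Sum>i\<in>UNIV. u $ i) = 1" "(\<Sum>i\<in>UNIV. v $ i) = 1"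
      then show "\<exists>x :: real^'n. s *\<^sub>R (\<Sum>i\<in>UNIV. u $ i *\<^sub>R p i) + t *\<^sub>R (\<Sum>i\<in>UNIV. v $ i *\<^sub>R p i)
          = (\<Sum>i\<in>UNIV. x $ i *\<^sub>R p i) \<and> (\<Sum>i\<in>UNIV. x $ i) = 1"
        by (intro exI[of _ "s *\<^sub>R u + t *\<^sub>R v"])
          (simp add: sum.distrib scaleR_sum_right scaleR_add_left flip: sum_distrib_left)
    qed
  qed
  show "?R \<subseteq> affine hull (range p)"
  proof clarify
    fix u :: "real^'n" assume u: "(\<Sum>i\<in>UNIV. u $ i) = 1"
    define f where "f y = (\<Sum>i | p i = y. u $ i)" for y
    have "sum f (range p) = 1"
      using sum.group[of UNIV "range p" p "\<lambda>i. u $ i"] u by (simp add: f_def)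
    moreover have "(\<Sum>y\<in>range p. f y *\<^sub>R y) = (\<Sum>i\<in>UNIV. u $ i *\<^sub>R p i)"
      using sum.group[of UNIV "range p" p "\<lambda>i. u $ i *\<^sub>R p i"]
      by (simp add: f_def scaleR_sum_left)
    ultimately show "(\<Sum>i\<in>UNIV. u $ i *\<^sub>R p i) \<in> affine hull (range p)"
      by (auto simp: affine_hull_finite)
  qed
qed

definition unit_gram :: "real^'n^'n \<Rightarrow> real^'n^'n" where
  "unit_gram D = (\<chi> i j. 1 - D $ i $ j / 2)"

text \<open>Forwards, \<open>unit_gram D\<close> is the Gram matrix of the points translated by the
  centre, and the barycentric weights of the centre form \<open>u\<close>. Backwards, the zero
  diagonal makes the Gram vectors unit vectors, and \<open>u\<close> writes the origin as an affine
  combination of them.\<close>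

lemma unit_spherical_edm_iff:
  fixes D :: "real^'n^'n"
  shows "unit_spherical_edm D \<longleftrightarrow> (\<forall>i. D $ i $ i = 0) \<and> psd (unit_gram D) \<and>
    (\<exists>u. unit_gram D *v u = 0 \<and> 1 \<bullet> u = 1)" (is "_ \<longleftrightarrow> ?R")
proof
  assume "unit_spherical_edm D"
  then obtain p :: "'n \<Rightarrow> real^'n" and a where p: "generating_points p D"
    "a \<in> affine hull (range p)" "\<And>i. norm (p i - a) = 1"
    unfolding unit_spherical_edm_def spherical_edm_def by blast
  have G: "unit_gram D $ i $ j = (p i - a) \<bullet> (p j - a)" for i j
  proof -
    have "(norm (p i - p j))\<^sup>2
        = (norm (p i - a))\<^sup>2 + (norm (p j - a))\<^sup>2 - 2 * ((p i - a) \<bullet> (p j - a))"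
      by (simp add: power2_norm_eq_inner inner_diff_left inner_diff_right inner_commute)
    then show ?thesis using p(1) 
      by (simp add: p(3) unit_gram_def generating_points_def diff_divide_distrib)
  qed
  note q = gram_quadratic_form[of "unit_gram D", OF G]
  have psd: "psd (unit_gram D)"
    unfolding psd_def q by (simp add: vec_eq_iff transpose_def G inner_commute)
  obtain u :: "real^'n" where u: "a = (\<Sum>i\<in>UNIV. u $ i *\<^sub>R p i)" "(\<Sum>i\<in>UNIV. u $ i) = 1"
    using p(2) unfolding affine_hull_range by blast
  have "(\<Sum>i\<in>UNIV. u $ i *\<^sub>R (p i - a)) = 0"
    using u by (simp add: scaleR_diff_right sum_subtractf flip: scaleR_sum_left)
  then have "unit_gram D *v u = 0" using psd_null[OF psd] q by simp
  moreover have "1 \<bullet> u = 1" using u(2) by (simp add: inner_vec_def)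
  moreover have "D $ i $ i = 0" for i using p(1) by (simp add: generating_points_def)
  ultimately show ?R using psd by blast
next
  assume R: ?R
  then obtain u where u: "unit_gram D *v u = 0" "1 \<bullet> u = 1" by blast
  from R obtain p :: "'n \<Rightarrow> real^'n" where p: "\<And>i j. unit_gram D $ i $ j = p i \<bullet> p j"
    using psd_gram by blast
  have D: "D $ i $ j = 2 - 2 * (p i \<bullet> p j)" for i j
    using p[of i j] by (simp add: unit_gram_def field_simps)
  have n: "p i \<bullet> p i = 1" for i using R D[of i i] by simp
  have "generating_points p D"
    unfolding generating_points_def power2_norm_eq_inner
    by (simp add: D inner_diff_left inner_diff_right n inner_commute)
  moreover have "0 \<in> affine hull (range p)"
  proof -
    have "(\<Sum>i\<in>UNIV. u $ i *\<^sub>R p i) = 0"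
      using gram_quadratic_form[of "unit_gram D" p u, OF p] u(1) by simp
    moreover have "(\<Sum>i\<in>UNIV. u $ i) = 1" using u(2) by (simp add: inner_vec_def)
    ultimately show ?thesis unfolding affine_hull_range by force
  qed
  ultimately show "unit_spherical_edm D"
    unfolding unit_spherical_edm_def using n
    by (intro spherical_edmI[of p D 0 1]) (auto simp: norm_eq_sqrt_inner)
qed

section \<open>Perturbation of one symmetric pair of entries\<close>

lemma sym_unit_mult:
  fixes x :: "real^'n"
  assumes "k \<noteq> l"
  shows "sym_unit k l *v x = x $ l *\<^sub>R axis k 1 + x $ k *\<^sub>R axis l 1"
proof -
  have "(\<Sum>j\<in>UNIV. sym_unit k l $ i $ j * x $ j) =
      (if i = k then x $ l else if i = l then x $ k else 0)" for i
    using assms by (auto simp: sym_unit_def if_distrib[of "\<lambda>y. y * _"] cong: if_cong)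
  then show ?thesis using assms by (auto simp: vec_eq_iff matrix_vector_mult_def axis_def)
qed

lemma unit_gram_perturb:
  "unit_gram (D + t *\<^sub>R sym_unit k l) = unit_gram D - (t / 2) *\<^sub>R sym_unit k l"
  by (simp add: vec_eq_iff unit_gram_def field_simps)

text \<open>
  A kernel vector of the perturbed matrix has the form \<open>u + \<tau> m h\<close> up to kernel vectors of
  \<open>G\<close> with coordinate sum 0. The first condition on the right comes from matching its entries
  at \<open>k\<close> and \<open>l\<close>, the second one from solvability for \<open>m\<close>. Definiteness is Cauchy-Schwarz for
  \<open>G\<close> applied to \<open>x\<close> and \<open>h\<close>.
\<close>

lemma perturbed_gram_iff:
  fixes G :: "real^'n^'n" and h u :: "real^'n"
  assumes G: "psd G" and kl: "k \<noteq> l"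
    and h: "G *v h = axis k 1 - c *\<^sub>R axis l 1" "1 \<bullet> h = 0"
    and u: "G *v u = 0" "1 \<bullet> u = 1" "u $ k = c * u $ l" "u $ k \<noteq> 0"
    and K: "\<And>x. G *v x = 0 \<Longrightarrow> 1 \<bullet> x = 0 \<Longrightarrow> x $ k = 0 \<and> x $ l = 0"
    and \<tau>: "\<tau> \<noteq> 0"
  shows "psd (G - \<tau> *\<^sub>R sym_unit k l) \<and>
      (\<exists>x. (G - \<tau> *\<^sub>R sym_unit k l) *v x = 0 \<and> 1 \<bullet> x = 1)
    \<longleftrightarrow> \<tau> * (h $ k - c * h $ l) = - 2 * c \<and> h $ k + c * h $ l \<noteq> 0" (is "?L \<longleftrightarrow> ?R")
proof
  have ul: "u $ l \<noteq> 0" "c \<noteq> 0" using u by auto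
  have pert: "(G - \<tau> *\<^sub>R sym_unit k l) *v x
      = G *v x - \<tau> *\<^sub>R (x $ l *\<^sub>R axis k 1 + x $ k *\<^sub>R axis l 1)" for x
    by (simp add: matrix_vector_mult_diff_rdistrib scaleR_matrix_vector_assoc[symmetric]
        sym_unit_mult[OF kl])
  {
    assume ?L
    then obtain x where x: "G *v x = \<tau> *\<^sub>R (x $ l *\<^sub>R axis k 1 + x $ k *\<^sub>R axis l 1)" "1 \<bullet> x = 1"
      unfolding pert by auto
    \<comment> \<open>The range of \<open>G\<close> is orthogonal to \<open>u\<close>, whose entries
      at \<open>k\<close> and \<open>l\<close> have ratio \<open>c\<close>; this fixes the ratio of
      the entries of \<open>x\<close>.\<close>
    have "0 = u \<bullet> (G *v x)" using psd_sym[OF G, of u x] u(1) by simp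
    also have "\<dots> = \<tau> * (x $ l * u $ k + x $ k * u $ l)"
      by (simp add: x(1) inner_add_right inner_axis)
    also have "\<dots> = \<tau> * u $ l * (c * x $ l + x $ k)" by (simp add: u(3) algebra_simps)
    finally have xk: "x $ k = - c * x $ l" using \<tau> ul by simp
    \<comment> \<open>Now \<open>G *v x\<close> is \<open>\<tau> * x $ l\<close> times
      \<open>G *v h\<close>. Subtracting that multiple of \<open>h\<close> leaves a kernel vector,
      and subtracting \<open>u\<close> makes its coordinate sum 0, as \<open>K\<close>
      requires.\<close>
    define y where "y = x - (\<tau> * x $ l) *\<^sub>R h - u"
    have "G *v y = 0"
      by (simp add: y_def matrix_vector_mult_diff_distrib matrix_vector_mult_scaleR x(1) u(1) h(1) xk
          algebra_simps)
    moreover have "1 \<bullet> y = 0" by (simp add: y_def inner_diff_right x(2) u(2) h(2))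
    ultimately have "y $ k = 0" "y $ l = 0" using K by auto
    then have *: "x $ k = \<tau> * x $ l * h $ k + c * u $ l" "x $ l = \<tau> * x $ l * h $ l + u $ l"
      by (auto simp: y_def u(3))
    then have xl: "x $ l \<noteq> 0" using ul by auto
    \<comment> \<open>Subtracting \<open>c\<close> times the second equation from the first cancels
      \<open>u $ l\<close>. Adding it instead yields the condition on
      \<open>h $ k + c * h $ l\<close> below.\<close>
    have "x $ l * (\<tau> * (h $ k - c * h $ l) + 2 * c) = 0"
      using * xk by algebra
    then have 1: "\<tau> * (h $ k - c * h $ l) = - 2 * c" using xl by simp
    have "h $ k + c * h $ l \<noteq> 0"
    proof
      assume "h $ k + c * h $ l = 0"
      then have "c * u $ l = 0" using * 1 by algebra
      then show False using ul by simp
    qed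
    with 1 show ?R by simp
  }
  assume ?R
  then have R: "\<tau> * (h $ k - c * h $ l) = - 2 * c" "h $ k + c * h $ l \<noteq> 0" by auto
  define \<delta> where "\<delta> = h $ k - c * h $ l"
  have \<delta>: "h \<bullet> (G *v h) = \<delta>"
    by (simp add: h(1) \<delta>_def inner_diff_right inner_axis)
  have "\<delta> \<noteq> 0" using R(1) ul by (auto simp: \<delta>_def)
  then have dpos: "\<delta> > 0" using \<delta> G unfolding psd_def by (metis less_eq_real_def)
  have \<tau>': "\<tau> = - 2 * c / \<delta>" using R(1) \<open>\<delta> \<noteq> 0\<close> by (simp add: \<delta>_def field_simps)
  have "psd (G - \<tau> *\<^sub>R sym_unit k l)" unfolding psd_def
  proof (intro conjI allI)
    show "transpose (G - \<tau> *\<^sub>R sym_unit k l) = G - \<tau> *\<^sub>R sym_unit k l"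
      using psd_index_sym[OF G] by (auto simp: vec_eq_iff transpose_def sym_unit_def)
    fix x
    have "x \<bullet> (G *v h) = x $ k - c * x $ l" by (simp add: h(1) inner_diff_right inner_axis)
    then have "(x $ k - c * x $ l)\<^sup>2 \<le> (x \<bullet> (G *v x)) * \<delta>"
      using psd_Cauchy_Schwarz[OF G, of x h] \<delta> by simp
    \<comment> \<open>The difference of the squares of \<open>x $ k - c * x $ l\<close> and
      \<open>x $ k + c * x $ l\<close> is \<open>- 4 * c * x $ k * x $ l\<close>, which is
      \<open>\<delta>\<close> times the term that the perturbation subtracts from the form.\<close>
    moreover have "0 \<le> (x $ k + c * x $ l)\<^sup>2" by simp
    ultimately have "- 4 * c * x $ k * x $ l \<le> (x \<bullet> (G *v x)) * \<delta>"
      by (simp add: power2_eq_square algebra_simps)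
    then have "- 4 * c * x $ k * x $ l / \<delta> \<le> x \<bullet> (G *v x)"
      using pos_divide_le_eq[OF dpos] by blast
    moreover have "x \<bullet> ((G - \<tau> *\<^sub>R sym_unit k l) *v x) = x \<bullet> (G *v x) - 2 * \<tau> * x $ k * x $ l"
      unfolding pert by (simp add: inner_diff_right inner_add_right inner_axis algebra_simps)
    ultimately show "0 \<le> x \<bullet> ((G - \<tau> *\<^sub>R sym_unit k l) *v x)" by (simp add: \<tau>')
  qed
  moreover have "\<exists>x. (G - \<tau> *\<^sub>R sym_unit k l) *v x = 0 \<and> 1 \<bullet> x = 1"
  proof -
    \<comment> \<open>If \<open>\<tau> * h $ l = 1\<close>, then \<open>R(1)\<close> gives
      \<open>\<tau> * h $ k = - c\<close>, against \<open>R(2)\<close>.\<close>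
    have nz: "1 - \<tau> * h $ l \<noteq> 0"
    proof
      assume "1 - \<tau> * h $ l = 0"
      then have "\<tau> * (h $ k + c * h $ l) = 0" using R(1) by algebra
      then show False using R(2) \<tau> by simp
    qed
    \<comment> \<open>\<open>m\<close> is to be the entry of \<open>x\<close> at \<open>l\<close>,
      so it must solve \<open>m = \<tau> * m * h $ l + u $ l\<close>.\<close>
    define m where "m = u $ l / (1 - \<tau> * h $ l)"
    have m: "m = \<tau> * m * h $ l + u $ l" using nz by (simp add: m_def field_simps)
    define x where "x = (\<tau> * m) *\<^sub>R h + u"
    have xl: "x $ l = m" using m by (simp add: x_def)
    have "x $ k = \<tau> * m * h $ k + c * u $ l" by (simp add: x_def u(3))
    then have xk: "x $ k = - c * m" using m R(1) by algebra
    have "(G - \<tau> *\<^sub>R sym_unit k l) *v x = 0"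
      unfolding pert xl xk
      by (simp add: x_def matrix_vector_right_distrib matrix_vector_mult_scaleR h(1) u(1)
          algebra_simps)
    moreover have "1 \<bullet> x = 1" by (simp add: x_def inner_add_right h(2) u(2))
    ultimately show ?thesis by blast
  qed
  ultimately show ?L by blast
qed


section \<open>Centring, kernels and the Gale matrix\<close>

lemma unit_gram_mult:
  "unit_gram D *v x = (1 \<bullet> x) *\<^sub>R 1 - (1/2) *\<^sub>R (D *v x)"
  by (simp add: vec_eq_iff unit_gram_def matrix_vector_mult_def inner_vec_def algebra_simps
      sum_subtractf sum_divide_distrib)

lemma centering_mult:
  fixes x :: "real^'n"
  shows "centering *v x = x - ((1 \<bullet> x) / real CARD('n)) *\<^sub>R 1"
  by (simp add: centering_def matrix_vector_mult_diff_rdistrib vec_eq_iff)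
    (simp add: matrix_vector_mult_def inner_vec_def sum_divide_distrib)

text \<open>The left kernel is the orthogonal complement of the range of \<open>P\<close>. Applied
  to the all-ones vector and a nonzero kernel vector of sum 0, this excludes
  \<open>r = n - 1\<close>.\<close>

lemma left_kernel_rank:
  fixes P :: "real^'r^'n"
  assumes "x v* P = 0" "y v* P = 0" "x \<bullet> y = 0" "x \<noteq> 0" "y \<noteq> 0"
  shows "rank P + 2 \<le> CARD('n)"
proof -
  define K where "K = {z \<in> UNIV. \<forall>p \<in> range ((*v) P). orthogonal p z}"
  have "dim K + dim (range ((*v) P)) = dim (UNIV :: (real^'n) set)"
    unfolding K_def
    by (intro dim_subspace_orthogonal_to_vectors) (auto intro: linear_subspace_image)
  then have dimK: "dim K + rank P = CARD('n)" by (simp add: rank_dim_range)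
  have "z v* P = 0 \<Longrightarrow> z \<in> K" for z
    by (auto simp: K_def orthogonal_def inner_commute[of _ z] dot_lmul_matrix[symmetric])
  then have sub: "{x, y} \<subseteq> K" using assms by auto
  have "x \<noteq> y" using assms by auto
  then have "card {x, y} = 2" by simp
  moreover have "independent {x, y}"
    using assms by (intro pairwise_orthogonal_independent)
      (auto simp: pairwise_def orthogonal_def inner_commute)
  ultimately have "2 \<le> dim K" using sub independent_card_le_dim by metis
  then show ?thesis using dimK by simp
qed

text \<open>The Gram matrix of \<open>p\<close> differs from \<open>- D / 2\<close> by terms with a
  constant row or column factor. These drop out of the form at a vector of sum 0, so the norm of the
  combination is 0.\<close>

lemma generating_points_relation:
  fixes p :: "'n::finite \<Rightarrow> 'a::euclidean_space"
  assumes p: "generating_points p D" and x: "1 \<bullet> x = 0" "x \<bullet> (D *v x) = 0"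
  shows "(\<Sum>i\<in>UNIV. x $ i *\<^sub>R p i) = 0"
proof -
  define G :: "real^'n^'n" where "G = (\<chi> i j. p i \<bullet> p j)"
  define q :: "real^'n" where "q = (\<chi> i. p i \<bullet> p i)"
  have Gij: "G $ i $ j = (q $ i + q $ j - D $ i $ j) / 2" for i j
    using p by (simp add: G_def q_def generating_points_def power2_norm_eq_inner inner_diff_left
        inner_diff_right inner_commute)
  have "G *v x = (1/2) *\<^sub>R ((1 \<bullet> x) *\<^sub>R q + (q \<bullet> x) *\<^sub>R 1 - D *v x)"
    by (simp add: vec_eq_iff matrix_vector_mult_def inner_vec_def Gij algebra_simps sum.distrib
        sum_subtractf sum_distrib_left add_divide_distrib diff_divide_distrib sum_divide_distrib)
  then have "x \<bullet> (G *v x) = 0"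
    using x by (simp add: inner_diff_right inner_commute[of x 1])
  then show ?thesis using gram_quadratic_form[of G p x] by (simp add: G_def)
qed

text \<open>Such an \<open>x\<close> is a relation between the generating points, hence lies in the
  column span of \<open>Z\<close>; a zero row of \<open>Z\<close> forces the matching coordinate to
  0 throughout that span.\<close>

lemma gale_kernel:
  fixes D :: "real^'n^'n" and Q :: "real^'r^'n" and Z :: "real^'m^'n"
  assumes gale: "gale_matrix D Q Z" and x: "1 \<bullet> x = 0" "x \<bullet> (D *v x) = 0" and row: "row i Z = 0"
  shows "x $ i = 0"
proof -
  have "(\<Sum>j\<in>UNIV. x $ j *\<^sub>R row j Q) = 0"
    using gale x by (intro generating_points_relation[of _ D]) (auto simp: gale_matrix_def)
  then have "transpose Q *v x = 0"
    by (simp add: vec_eq_iff vector_matrix_mult_def row_def mult.commute)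
  moreover have "(\<Sum>j\<in>UNIV. x $ j) = 0" using x(1) by (simp add: inner_vec_def)
  ultimately have "x \<in> span (columns Z)" using gale by (simp add: gale_matrix_def)
  also have "span (columns Z) \<subseteq> {y. y $ i = 0}"
  proof (rule span_minimal)
    show "columns Z \<subseteq> {y. y $ i = 0}"
      using row by (auto simp: columns_def column_def row_def vec_eq_iff)
  qed (simp add: subspace_def)
  finally show ?thesis by simp
qed

section \<open>The perturbation set from the rows of \<open>S\<close>\<close>

theorem corollary4p1:
  fixes D B :: "real^'n^'n" and P S Q :: "real^'r^'n" and Z :: "real^'m^'n"
    and w :: "real^'n" and k l :: 'n and c :: real
  assumes "unit_spherical_edm D"
    and "embedding_dim D = CARD('r)"
    and "B = - (1/2) *\<^sub>R (centering ** D ** centering)"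
    and "B = P ** transpose P" and "rank P = CARD('r)"
    and "S = P ** matrix_inv (transpose P ** P)"
    and "CARD('r) + 2 \<le> CARD('n) \<Longrightarrow> gale_matrix D Q Z"
    and "w = pinv D *v 1"
    and "k \<noteq> l"
    and "w $ k = c * w $ l" and "w $ k \<noteq> 0"
    and "CARD('r) + 1 = CARD('n) \<or> (row k Z = 0 \<and> row l Z = 0)"
  shows "unit_spherical_set D k l =
     (if (norm (row k S))\<^sup>2 = c\<^sup>2 * (norm (row l S))\<^sup>2 then {0}
      else {0, - 4 * c / (norm (row k S - c *\<^sub>R row l S))\<^sup>2})"
proof -
  define G where "G = unit_gram D"
  have diag: "D $ i $ i = 0" for i using assms(1) unit_spherical_edm_iff by blast
  have G: "psd G" using assms(1) unit_spherical_edm_iff G_def by blast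
  obtain u0 where u0: "G *v u0 = 0" "1 \<bullet> u0 = 1"
    using assms(1) unit_spherical_edm_iff G_def by blast
  have Gx: "G *v x = (1 \<bullet> x) *\<^sub>R 1 - (1/2) *\<^sub>R (D *v x)" for x
    by (simp add: G_def unit_gram_mult)
  have one: "(1 :: real^'n) \<noteq> 0" by (simp add: vec_eq_iff)

  have Du0: "D *v u0 = 2 *\<^sub>R 1" using Gx[of u0] u0 by (simp add: vec_eq_iff)
  define u where "u = 2 *\<^sub>R w"
  \<comment> \<open>The all-ones vector is \<open>D\<close> applied to half of \<open>u0\<close>, so
    \<open>D ** pinv D ** D = D\<close> applies to it.\<close>
  have "D *v w = (1/2) *\<^sub>R ((D ** pinv D ** D) *v u0)"
    by (simp add: assms(8) matrix_vector_mul_assoc[symmetric] Du0 matrix_vector_mult_scaleR)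
  also have "\<dots> = 1"
    using Moore_Penrose_pinv[of D] Du0 by (simp add: Moore_Penrose_def)
  finally have Dw: "D *v w = 1" .
  \<comment> \<open>Pairing with \<open>u0\<close> fixes the coordinate sum of \<open>w\<close> at
    1/2, which explains the factor 2 in \<open>u\<close>.\<close>
  have "0 = u0 \<bullet> (G *v w)" using psd_sym[OF G, of u0 w] u0 by simp
  then have w1: "1 \<bullet> w = 1/2" using u0(2) by (simp add: Gx Dw inner_diff_right inner_commute)
  have u: "G *v u = 0" "1 \<bullet> u = 1" "u $ k = c * u $ l" "u $ k \<noteq> 0"
    using Dw w1 assms(10,11) by (simp_all add: u_def matrix_vector_mult_scaleR Gx)
  have u_orth: "u \<bullet> (G *v x) = 0" for x using psd_sym[OF G, of u x] u(1) by simp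

  have Bx: "B *v x = centering *v (- (1/2) *\<^sub>R (D *v (centering *v x)))" for x
    by (simp add: assms(3) scaleR_matrix_vector_assoc[symmetric] matrix_vector_mul_assoc[symmetric]
        matrix_vector_mult_scaleR flip: scaleR_minus_left)
  have BG: "B *v x = centering *v (G *v x)" if "1 \<bullet> x = 0" for x
    using that by (simp add: Bx Gx centering_mult[of x])
  have PP: "B *v x = P *v (x v* P)" for x
    by (simp add: assms(4) matrix_vector_mul_assoc[symmetric])
  have "(1 v* P) \<bullet> (1 v* P) = 1 \<bullet> (B *v 1)" by (simp add: PP dot_lmul_matrix)
  also have "B *v 1 = 0"
    by (simp add: Bx centering_mult[of 1] inner_vec_def matrix_vector_mult_0_right)
  finally have P1: "1 v* P = 0" by simp
  \<comment> \<open>Centring kills only multiples of the all-ones vector, and \<open>u\<close>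
    detects these. This allows centring to be cancelled from identities between vectors orthogonal
    to \<open>u\<close>.\<close>
  have orth1: "x = 0" if x: "centering *v x = 0" "u \<bullet> x = 0" for x
  proof -
    obtain \<kappa> where \<kappa>: "x = \<kappa> *\<^sub>R 1" using x(1) by (auto simp: centering_mult)
    then show ?thesis using x(2) u(2) by (simp add: inner_commute)
  qed
  have ker_iff: "x v* P = 0 \<longleftrightarrow> G *v x = 0" if x: "1 \<bullet> x = 0" for x
  proof
    assume "x v* P = 0"
    then show "G *v x = 0" using BG[OF x] PP[of x] orth1 u_orth by simp
  next
    assume "G *v x = 0"
    then have "(x v* P) \<bullet> (x v* P) = 0"
      using BG[OF x] PP[of x] by (simp add: dot_lmul_matrix)
    then show "x v* P = 0" by simp
  qed
  \<comment> \<open>A nonzero \<open>x\<close> and the all-ones vector are orthogonal and both in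
    the left kernel of \<open>P\<close>, so only the case of zero rows of \<open>Z\<close>
    remains.\<close>
  have K: "x $ k = 0 \<and> x $ l = 0" if x: "G *v x = 0" "1 \<bullet> x = 0" for x
  proof (cases "x = 0")
    case False
    then have "CARD('r) + 2 \<le> CARD('n)"
      using left_kernel_rank[of 1 P x] P1 ker_iff x one assms(5) by simp
    moreover from this have "row k Z = 0" "row l Z = 0" using assms(12) by auto
    moreover have "x \<bullet> (D *v x) = 0" using x Gx[of x] by simp
    ultimately show ?thesis using gale_kernel[OF assms(7) x(2)] by blast
  qed simp

  define M N where "M = transpose P ** P" and "N = matrix_inv M"
  have "M *v x = 0 \<Longrightarrow> x = 0" for x
  proof -
    assume "M *v x = 0"
    then have "(P *v x) v* P = 0"
      by (simp add: M_def matrix_vector_mul_assoc[symmetric])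
    then have "(P *v x) \<bullet> (P *v x) = 0"
      by (simp flip: dot_lmul_matrix)
    then show "x = 0"
      using assms(5) matrix_nonfull_linear_equations_eq[of P] by auto
  qed
  then have "invertible M"
    by (simp add: invertible_left_inverse matrix_left_invertible_ker)
  then have MN: "M ** N = mat 1"
    unfolding N_def matrix_inv_def invertible_def by (metis (mono_tags, lifting) someI_ex)
  have "transpose N ** M = mat 1"
    using arg_cong[OF MN, of transpose] by (simp add: matrix_transpose_mul M_def transpose_mat)
  then have N_sym: "transpose N = N"
    using MN by (metis matrix_mul_assoc matrix_mul_lid matrix_mul_rid)
  have S: "S = P ** N" by (simp add: assms(6) M_def N_def)
  have Sx: "S *v y = P *v (N *v y)" for y by (simp add: S matrix_vector_mul_assoc)
  have Sx': "x v* S = N *v (x v* P)" for x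
  proof -
    have "transpose S *v x = N *v (transpose P *v x)"
      by (simp only: S matrix_transpose_mul N_sym matrix_vector_mul_assoc)
    then show ?thesis by simp
  qed
  have PS: "(S *v y) v* P = y" for y
  proof -
    have "transpose P *v (P *v (N *v y)) = (M ** N) *v y"
      by (simp only: M_def matrix_vector_mul_assoc matrix_mul_assoc)
    then show ?thesis by (simp add: Sx MN)
  qed
  have oneS: "1 \<bullet> (S *v y) = 0" for y
    by (simp add: Sx P1 flip: dot_lmul_matrix)

  define v :: "real^'n" where "v = axis k 1 - c *\<^sub>R axis l 1"
  \<comment> \<open>\<open>S\<close> times its transpose is the pseudoinverse of \<open>B\<close>,
    and \<open>B\<close> agrees with the centred \<open>G\<close> on vectors of sum 0.\<close>
  define h where "h = S *v (v v* S)"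
  have vx: "x \<bullet> v = x $ k - c * x $ l" for x by (simp add: v_def inner_diff_right inner_axis)
  have h1: "1 \<bullet> h = 0" by (simp add: h_def oneS)
  \<comment> \<open>The second term is the orthogonal projection of \<open>v\<close> onto the column
    space of \<open>P\<close>. The remainder \<open>y\<close> is thus in the kernel of
    \<open>G\<close> with sum 0, so \<open>K\<close> makes it orthogonal to \<open>v\<close>, and
    then to itself.\<close>
  define y where "y = centering *v v - S *v (v v* P)"
  have y1: "1 \<bullet> y = 0"
    by (simp add: y_def inner_diff_right oneS centering_mult) (simp add: inner_vec_def)
  have yP: "y v* P = 0"
  proof -
    have "transpose P *v y = transpose P *v v - transpose P *v (S *v (v v* P))
        - ((1 \<bullet> v) / real CARD('n)) *\<^sub>R (transpose P *v 1)"
      by (simp only: y_def centering_mult matrix_vector_mult_diff_distrib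
          matrix_vector_mult_scaleR) (simp only: algebra_simps)
    then show ?thesis by (simp add: PS P1)
  qed
  have "y $ k = 0 \<and> y $ l = 0" using K y1 yP ker_iff by blast
  then have "y \<bullet> v = 0" "y \<bullet> 1 = 0" using y1 by (simp_all add: vx inner_commute[of y 1])
  then have "y \<bullet> y = - (y \<bullet> (S *v (v v* P)))"
    by (subst (2) y_def) (simp add: centering_mult inner_diff_right)
  also have "y \<bullet> (S *v (v v* P)) = 0"
    by (simp add: Sx yP flip: dot_lmul_matrix)
  finally have "centering *v v = S *v (v v* P)" by (simp add: y_def)
  also have "\<dots> = B *v h" by (simp only: PP h_def PS) (simp only: Sx Sx')
  also have "\<dots> = centering *v (G *v h)" by (simp add: BG h1)
  finally have "centering *v (G *v h - v) = 0" by (simp add: matrix_vector_mult_diff_distrib)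
  \<comment> \<open>Orthogonality of \<open>u\<close> and \<open>v\<close> is the hypothesis
    relating \<open>w $ k\<close> and \<open>w $ l\<close>; it lets \<open>orth1\<close> cancel the
    centring.\<close>
  moreover have "u \<bullet> (G *v h - v) = 0" by (simp add: inner_diff_right u_orth vx u(3))
  ultimately have Gh: "G *v h = axis k 1 - c *\<^sub>R axis l 1"
    using orth1[of "G *v h - v"] by (simp add: v_def)

  define a b where "a = row k S" and "b = row l S"
  have "v v* S = a - c *\<^sub>R b"
  proof -
    have "(v v* S) $ j = (column j S) \<bullet> v" for j
      by (simp add: vector_matrix_mult_def inner_vec_def column_def mult.commute)
    then show ?thesis by (simp add: vec_eq_iff vx column_def a_def b_def row_def)
  qed
  then have h_kl: "h $ k = a \<bullet> (a - c *\<^sub>R b)" "h $ l = b \<bullet> (a - c *\<^sub>R b)"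
    by (simp_all add: h_def a_def b_def matrix_vector_mul_component row_def)
  have hk: "h $ k - c * h $ l = (norm (a - c *\<^sub>R b))\<^sup>2"
    "h $ k + c * h $ l = (norm a)\<^sup>2 - c\<^sup>2 * (norm b)\<^sup>2"
    unfolding power2_norm_eq_inner h_kl
    by (simp_all add: inner_diff_left inner_diff_right inner_commute power2_eq_square algebra_simps)

  have c: "c \<noteq> 0" using u(3,4) by auto
  have mem: "t \<in> unit_spherical_set D k l \<longleftrightarrow> t = 0 \<or>
      t * (norm (a - c *\<^sub>R b))\<^sup>2 = - 4 * c \<and> (norm a)\<^sup>2 \<noteq> c\<^sup>2 * (norm b)\<^sup>2" for t
  proof (cases "t = 0")
    case True
    then show ?thesis using assms(1) by (simp add: unit_spherical_set_def)
  next
    case False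
    have "(D + t *\<^sub>R sym_unit k l) $ i $ i = 0" for i
      using diag assms(9) by (auto simp: sym_unit_def)
    then have "t \<in> unit_spherical_set D k l \<longleftrightarrow> psd (G - (t / 2) *\<^sub>R sym_unit k l) \<and>
        (\<exists>x. (G - (t / 2) *\<^sub>R sym_unit k l) *v x = 0 \<and> 1 \<bullet> x = 1)"
      unfolding unit_spherical_set_def mem_Collect_eq unit_spherical_edm_iff unit_gram_perturb
        G_def by simp
    also have "\<dots> \<longleftrightarrow> t / 2 * (h $ k - c * h $ l) = - 2 * c \<and> h $ k + c * h $ l \<noteq> 0"
      using False by (intro perturbed_gram_iff[OF G assms(9) Gh h1 u K]) auto
    finally show ?thesis using False by (auto simp: hk)
  qed
  \<comment> \<open>For \<open>d = 0\<close> the quotient is 0 by convention, while the equation on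
    the left has no solution since \<open>c \<noteq> 0\<close>; both sides then reduce to
    \<open>t = 0\<close>.\<close>
  have quot: "t = 0 \<or> t * d = - 4 * c \<longleftrightarrow> t \<in> {0, - 4 * c / d}" for t d :: real
    using c by (cases "d = 0") (auto simp: field_simps)
  show ?thesis
  proof (cases "(norm a)\<^sup>2 = c\<^sup>2 * (norm b)\<^sup>2")
    case True
    then have "unit_spherical_set D k l = {0}" by (auto simp: mem)
    then show ?thesis using True by (simp add: a_def b_def)
  next
    case False
    then have "unit_spherical_set D k l = {0, - 4 * c / (norm (a - c *\<^sub>R b))\<^sup>2}"
      unfolding set_eq_iff mem quot[symmetric] by blast
    then show ?thesis using False by (simp add: a_def b_def)
  qed
qed

end
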